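(* Let $F$ be a field of characteristic not $2$ and let $R$ be a unital commutative associative $F$-algebra. Then $$\mathrm{Der}_F(\mathfrak{sl}_2(R))=\mathrm{InnD}(\mathfrak{sl}_2(R))\oplus \mathrm{Der}_F(R)$$ (an internal direct sum of $F$-vector subspaces of $\mathrm{Der}_F(\mathfrak{sl}_2(R))$).
   Context: $\mathfrak{sl}_2(R)$ denotes the set of $2\times 2$ matrices $\begin{pmatrix}a&b\\ c&-a\end{pmatrix}$ with $a,b,c\in R$, viewed as a Lie algebra over $F$ under the commutator bracket. $\mathrm{Der}_F(\mathfrak{sl}_2(R))$ is the Lie algebra of all $F$-linear derivations of $\mathfrak{sl}_2(R)$, and $\mathrm{InnD}(\mathfrak{sl}_2(R))=\{\mathrm{ad}\,Z\mid Z\in\mathfrak{sl}_2(R)\}$ is its ideal of inner derivations. $\mathrm{Der}_F(R)$ is the Lie algebra of $F$-linear derivations of $R$; it is identified with a subalgebra of $\mathrm{Der}_F(\mathfrak{sl}_2(R))$ by letting $D\in \mathrm{Der}_F(R)$ act entrywise: $D\begin{pmatrix}a&b\\ c&-a\end{pmatrix}=\begin{pmatrix}D(a)&D(b)\\ D(c)&-D(a)\end{pmatrix}$. *)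

theory Defs
  imports "Jordan_Normal_Form.Matrix" "HOL-Library.Function_Algebras"
begin

section \<open>Algebras, derivations and internal direct sums\<close>

text \<open>
  A unital commutative associative algebra over a field. The sort
  \<open>{comm_ring, comm_monoid_mult}\<close> is that of commutative unital rings; unlike \<open>comm_ring_1\<close>
  it does not exclude the zero ring.
\<close>

locale comm_unital_algebra = vector_space scale
  for scale :: "'f::field \<Rightarrow> 'r::{comm_ring, comm_monoid_mult} \<Rightarrow> 'r" +
  assumes scale_mult_left: "scale c (x * y) = scale c x * y"

text \<open>
  The derivations, linear with respect to \<open>scale\<close>, of a not necessarily associative algebra
  with product \<open>mul\<close>. It is used both for the product of a ring and for a Lie bracket.
\<close>

definition derivations ::
    "('f::field \<Rightarrow> 'a::ab_group_add \<Rightarrow> 'a) \<Rightarrow> ('a \<Rightarrow> 'a \<Rightarrow> 'a) \<Rightarrow> ('a \<Rightarrow> 'a) set" where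
  "derivations scale mul =
     {D. Vector_Spaces.linear scale scale D \<and>
         (\<forall>x y. D (mul x y) = mul (D x) y + mul x (D y))}"

definition internal_direct_sum ::
    "('f::field \<Rightarrow> 'v::ab_group_add \<Rightarrow> 'v) \<Rightarrow> 'v set \<Rightarrow> 'v set \<Rightarrow> 'v set \<Rightarrow> bool" where
  "internal_direct_sum scale V U W \<longleftrightarrow>
     module.subspace scale U \<and> module.subspace scale W \<and>
     V = {u + w | u w. u \<in> U \<and> w \<in> W} \<and> U \<inter> W = {0}"


section \<open>The Lie algebra of trace zero two by two matrices\<close>

typedef (overloaded) ('a::comm_ring) sl2 =
  "{mat_of_rows_list 2 [[a, b], [c, - a]] | a b c :: 'a. True}"
  morphisms mat_of_sl2 Abs_sl2
  by blast

setup_lifting type_definition_sl2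

lift_definition Sl2 :: "'a::comm_ring \<Rightarrow> 'a \<Rightarrow> 'a \<Rightarrow> 'a sl2"
  is "\<lambda>a b c. mat_of_rows_list 2 [[a, b], [c, - a]]"
  by blast

lemma mat2_eq_iff:
  "mat_of_rows_list 2 [[a, b], [c, d]] = mat_of_rows_list 2 [[a', b'], [c', d']] \<longleftrightarrow>
     a = a' \<and> b = b' \<and> c = c' \<and> d = d'" (is "?A = ?B \<longleftrightarrow> _")
proof
  assume eq: "?A = ?B"
  have "?A $$ (i, j) = ?B $$ (i, j)" for i j by (simp add: eq)
  from this[of 0 0] this[of 0 1] this[of 1 0] this[of 1 1]
  show "a = a' \<and> b = b' \<and> c = c' \<and> d = d'"
    by (simp add: mat_of_rows_list_def)
qed simp

lemma mat2_plus:
  "mat_of_rows_list 2 [[a, b], [c, d]] + mat_of_rows_list 2 [[a', b'], [c', d']] =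
     mat_of_rows_list 2 [[a + a', b + b'], [c + c', d + d']]"
  by (rule eq_matI) (auto simp: mat_of_rows_list_def numeral_2_eq_2 less_Suc_eq)

lemma mat2_minus:
  "mat_of_rows_list 2 [[a, b], [c, d]] - mat_of_rows_list 2 [[a', b'], [c', d']] =
     mat_of_rows_list 2 [[a - a', b - b'], [c - c', d - d']]"
  by (rule eq_matI) (auto simp: mat_of_rows_list_def numeral_2_eq_2 less_Suc_eq)

lemma mat2_uminus:
  "- mat_of_rows_list 2 [[a, b], [c, d]] = mat_of_rows_list 2 [[- a, - b], [- c, - d]]"
  by (rule eq_matI) (auto simp: mat_of_rows_list_def numeral_2_eq_2 less_Suc_eq)

lemma mat2_zero: "0\<^sub>m 2 2 = mat_of_rows_list 2 [[0, 0], [0, 0]]"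
  by (rule eq_matI) (auto simp: mat_of_rows_list_def numeral_2_eq_2 less_Suc_eq)

lemma mat2_times:
  fixes a :: "'a::comm_ring"
  shows "mat_of_rows_list 2 [[a, b], [c, d]] * mat_of_rows_list 2 [[a', b'], [c', d']] =
     mat_of_rows_list 2 [[a * a' + b * c', a * b' + b * d'], [c * a' + d * c', c * b' + d * d']]"
  by (rule eq_matI)
    (auto simp: mat_of_rows_list_def numeral_2_eq_2 less_Suc_eq scalar_prod_def)

lemma mat2_commutator:
  fixes a b c a' b' c' :: "'a::comm_ring"
  defines "X \<equiv> mat_of_rows_list 2 [[a, b], [c, - a]]"
    and "Y \<equiv> mat_of_rows_list 2 [[a', b'], [c', - a']]"
  shows "X * Y - Y * X =
     mat_of_rows_list 2 [[b * c' - b' * c, (a * b' - a' * b) + (a * b' - a' * b)],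
       [(c * a' - c' * a) + (c * a' - c' * a), - (b * c' - b' * c)]]"
  unfolding X_def Y_def by (simp add: mat2_times mat2_minus mat2_eq_iff algebra_simps)

instantiation sl2 :: (comm_ring) ab_group_add
begin

lift_definition zero_sl2 :: "'a sl2" is "0\<^sub>m 2 2"
  by (force simp: mat2_zero mat2_eq_iff)

lift_definition plus_sl2 :: "'a sl2 \<Rightarrow> 'a sl2 \<Rightarrow> 'a sl2" is "(+)"
  by (force simp: mat2_plus mat2_eq_iff)

lift_definition minus_sl2 :: "'a sl2 \<Rightarrow> 'a sl2 \<Rightarrow> 'a sl2" is "(-)"
  by (force simp: mat2_minus mat2_eq_iff)

lift_definition uminus_sl2 :: "'a sl2 \<Rightarrow> 'a sl2" is uminus
  by (force simp: mat2_uminus mat2_eq_iff)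

instance
  by standard
    (transfer; force simp: mat2_plus mat2_minus mat2_uminus mat2_zero mat2_eq_iff algebra_simps)+

end

lift_definition sl2_bracket :: "'a::comm_ring sl2 \<Rightarrow> 'a sl2 \<Rightarrow> 'a sl2"
  is "\<lambda>X Y. X * Y - Y * X"
  using mat2_commutator by blast

definition inner_derivations :: "('a::comm_ring sl2 \<Rightarrow> 'a sl2) set" where
  "inner_derivations = range sl2_bracket"

text \<open>
  The entrywise action of a map. The last entry is made the negative of the first one, so that
  the definition makes sense for every \<open>f\<close>; for odd \<open>f\<close>, in particular for additive \<open>f\<close>, it is
  really entrywise (lemma \<open>mat_of_sl2_map\<close>).
\<close>

definition sl2_map :: "('a::comm_ring \<Rightarrow> 'a) \<Rightarrow> 'a sl2 \<Rightarrow> 'a sl2" where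
  "sl2_map f X = Sl2 (f (mat_of_sl2 X $$ (0, 0))) (f (mat_of_sl2 X $$ (0, 1)))
                     (f (mat_of_sl2 X $$ (1, 0)))"

definition sl2_scale :: "('f \<Rightarrow> 'a::comm_ring \<Rightarrow> 'a) \<Rightarrow> 'f \<Rightarrow> 'a sl2 \<Rightarrow> 'a sl2" where
  "sl2_scale scale c = sl2_map (scale c)"

lemma Sl2_cases [cases type: sl2]: obtains a b c where "X = Sl2 a b c"
proof -
  have "\<exists>a b c. X = Sl2 a b c" by transfer blast
  then show thesis using that by blast
qed

lemma Sl2_eq_iff [simp]: "Sl2 a b c = Sl2 a' b' c' \<longleftrightarrow> a = a' \<and> b = b' \<and> c = c'"
  by transfer (auto simp: mat2_eq_iff)

lemma zero_Sl2: "0 = Sl2 0 0 0"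
  by transfer (simp add: mat2_zero)

lemma plus_Sl2 [simp]: "Sl2 a b c + Sl2 a' b' c' = Sl2 (a + a') (b + b') (c + c')"
  by transfer (simp add: mat2_plus)

lemma minus_Sl2 [simp]: "Sl2 a b c - Sl2 a' b' c' = Sl2 (a - a') (b - b') (c - c')"
  by transfer (simp add: mat2_minus)

lemma bracket_Sl2 [simp]:
  "sl2_bracket (Sl2 a b c) (Sl2 a' b' c') =
     Sl2 (b * c' - b' * c) ((a * b' - a' * b) + (a * b' - a' * b))
       ((c * a' - c' * a) + (c * a' - c' * a))"
  by transfer (rule mat2_commutator)

lemma map_Sl2 [simp]: "sl2_map f (Sl2 a b c) = Sl2 (f a) (f b) (f c)"
  unfolding sl2_map_def Sl2.rep_eq by (simp add: mat_of_rows_list_def)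

lemma scale_Sl2 [simp]: "sl2_scale s k (Sl2 a b c) = Sl2 (s k a) (s k b) (s k c)"
  by (simp add: sl2_scale_def)

lemma mat_of_sl2_map:
  assumes "\<And>x. f (- x) = - f x"
  shows "mat_of_sl2 (sl2_map f X) = map_mat f (mat_of_sl2 X)"
  by (cases X, simp add: Sl2.rep_eq, rule eq_matI)
    (auto simp: mat_of_rows_list_def numeral_2_eq_2 less_Suc_eq assms)

lemma sl2_jacobi:
  "sl2_bracket X (sl2_bracket Y Z) + sl2_bracket Y (sl2_bracket Z X)
     + sl2_bracket Z (sl2_bracket X Y) = 0"
  by (cases X; cases Y; cases Z) (simp add: zero_Sl2 algebra_simps)

lemma vector_space_sl2:
  assumes "vector_space scale"
  shows "vector_space (sl2_scale scale)"
proof -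
  interpret vector_space scale by fact
  show ?thesis
  proof
    fix k l and X Y :: "'b sl2"
    show "sl2_scale scale k (X + Y) = sl2_scale scale k X + sl2_scale scale k Y"
      by (cases X; cases Y) (simp add: scale_right_distrib)
    show "sl2_scale scale (k + l) X = sl2_scale scale k X + sl2_scale scale l X"
      by (cases X) (simp add: scale_left_distrib)
    show "sl2_scale scale k (sl2_scale scale l X) = sl2_scale scale (k * l) X"
      by (cases X) simp
    show "sl2_scale scale 1 X = X"
      by (cases X) simp
  qed
qed

text \<open>
  The next three lemmas justify viewing the derivations of the ring as a Lie subalgebra of the
  derivations of \<open>sl2\<close>.
\<close>

lemma inj_sl2_map: "inj sl2_map"
proof (rule injI)
  fix f g :: "'a \<Rightarrow> 'a"
  assume eq: "sl2_map f = sl2_map g"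
  show "f = g"
  proof
    fix x
    have "sl2_map f (Sl2 x 0 0) = sl2_map g (Sl2 x 0 0)" by (simp only: eq)
    then show "f x = g x" by simp
  qed
qed

lemma sl2_map_commutator:
  "sl2_map (\<lambda>x. f (g x) - g (f x)) = (\<lambda>X. sl2_map f (sl2_map g X) - sl2_map g (sl2_map f X))"
  by (rule ext, rule_tac X = X in Sl2_cases) simp

lemma sl2_map_derivation:
  assumes "D \<in> derivations scale (*)"
  shows "sl2_map D \<in> derivations (sl2_scale scale) sl2_bracket"
proof -
  interpret Vector_Spaces.linear scale scale D using assms by (simp add: derivations_def)
  interpret sl2: vector_space "sl2_scale scale"
    by (rule vector_space_sl2) (rule vs1.vector_space_axioms)
  have D: "D (x * y) = D x * y + x * D y" for x y
    using assms by (simp add: derivations_def)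
  have "Vector_Spaces.linear (sl2_scale scale) (sl2_scale scale) (sl2_map D)"
  proof
    fix k X Y
    show "sl2_map D (X + Y) = sl2_map D X + sl2_map D Y"
      by (cases X; cases Y) (simp add: add)
    show "sl2_map D (sl2_scale scale k X) = sl2_scale scale k (sl2_map D X)"
      by (cases X) (simp add: scale)
  qed
  moreover have "sl2_map D (sl2_bracket X Y) =
      sl2_bracket (sl2_map D X) Y + sl2_bracket X (sl2_map D Y)" for X Y
    by (cases X; cases Y) (simp add: add diff D algebra_simps)
  ultimately show ?thesis by (simp add: derivations_def)
qed

end

theory Submission
  imports Defs
begin

text \<open>
  Write \<open>E = Sl2 0 1 0\<close>, \<open>F = Sl2 0 0 1\<close> and \<open>H = Sl2 1 0 0 = [E, F]\<close>. Since the scalar \<open>2\<close> is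
  invertible, the relations \<open>[H, E] = 2 E\<close> and \<open>[H, F] = -2 F\<close> force the values of a derivation
  \<open>D\<close> at \<open>E\<close> and \<open>F\<close> to be those of some inner derivation \<open>ad Z\<close> (lemma
  \<open>derivation_agrees_with_inner\<close>). The difference \<open>D - ad Z\<close> is a derivation that kills \<open>E\<close> and
  \<open>F\<close>, hence commutes with \<open>ad H\<close>, \<open>ad E\<close> and \<open>ad F\<close>. It therefore preserves the set of all
  \<open>a H\<close>, which is the centralizer of \<open>H\<close>, and acts there by a map \<open>d\<close>. Bracketing with \<open>E\<close> and
  \<open>F\<close> carries \<open>d\<close> to the other two entries, and \<open>[a E, b F] = a b H\<close> says that \<open>d\<close> is a
  derivation of the ring (lemma \<open>derivation_killing_EF_entrywise\<close>).

  The sum is direct because a derivation of the ring kills \<open>1\<close>, so that its entrywise action kills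
  \<open>E\<close> and \<open>F\<close>, whereas the only inner derivation that kills both is zero (lemma
  \<open>inner_killing_EF\<close>).
\<close>

section \<open>Vector spaces of maps\<close>

lemma vector_space_pointwise:
  assumes "vector_space scale"
  shows "vector_space (\<lambda>k (f :: 'b \<Rightarrow> 'a::ab_group_add) x. scale k (f x))"
proof -
  interpret vector_space scale by fact
  show ?thesis
    by standard (simp_all add: fun_eq_iff scale_right_distrib scale_left_distrib)
qed

lemma derivationsI:
  assumes "vector_space scale"
    and "\<And>x y. D (x + y) = D x + D y" and "\<And>k x. D (scale k x) = scale k (D x)"
    and "\<And>x y. D (mul x y) = mul (D x) y + mul x (D y)"
  shows "D \<in> derivations scale mul"
proof -
  interpret vector_space scale by fact
  have "Vector_Spaces.linear scale scale D" by standard (simp_all add: assms)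
  then show ?thesis by (simp add: derivations_def assms)
qed

lemma derivationsD:
  assumes "D \<in> derivations scale mul"
  shows "D (x + y) = D x + D y" and "D (x - y) = D x - D y" and "D 0 = 0"
    and "D (scale k x) = scale k (D x)" and "D (mul x y) = mul (D x) y + mul x (D y)"
proof -
  interpret Vector_Spaces.linear scale scale D using assms by (simp add: derivations_def)
  show "D (x + y) = D x + D y" "D (x - y) = D x - D y" "D 0 = 0" "D (scale k x) = scale k (D x)"
    by (simp_all add: add diff scale)
  show "D (mul x y) = mul (D x) y + mul x (D y)" using assms by (simp add: derivations_def)
qed

lemma subspace_derivations:
  assumes vs: "vector_space scale"
    and left: "\<And>y. Vector_Spaces.linear scale scale (\<lambda>x. mul x y)"
    and right: "\<And>x. Vector_Spaces.linear scale scale (mul x)"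
  shows "module.subspace (\<lambda>k D x. scale k (D x)) (derivations scale mul)"
proof -
  interpret vector_space scale by fact
  interpret maps: vector_space "\<lambda>k (D :: 'b \<Rightarrow> 'b) x. scale k (D x)"
    by (rule vector_space_pointwise) fact
  interpret l: Vector_Spaces.linear scale scale "\<lambda>x. mul x y" for y by (rule left)
  interpret r: Vector_Spaces.linear scale scale "mul x" for x by (rule right)
  show ?thesis
  proof (rule maps.subspaceI)
    show "0 \<in> derivations scale mul"
      by (rule derivationsI[OF vs]) (simp_all add: l.zero r.zero)
    show "D + D' \<in> derivations scale mul"
      if "D \<in> derivations scale mul" "D' \<in> derivations scale mul" for D D'
      by (rule derivationsI[OF vs])
        (simp_all add: derivationsD[OF that(1)] derivationsD[OF that(2)]
          l.add r.add scale_right_distrib)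
    show "(\<lambda>x. scale k (D x)) \<in> derivations scale mul"
      if "D \<in> derivations scale mul" for k D
      by (rule derivationsI[OF vs])
        (simp_all add: derivationsD[OF that] l.scale r.scale scale_right_distrib mult.commute)
  qed
qed


section \<open>The algebra and its two spaces of derivations\<close>

context comm_unital_algebra
begin

sublocale sl2: vector_space "sl2_scale scale"
  by (rule vector_space_sl2) (rule vector_space_axioms)

sublocale ring_maps: vector_space "\<lambda>k (D :: 'r \<Rightarrow> 'r) x. scale k (D x)"
  by (rule vector_space_pointwise) (rule vector_space_axioms)

sublocale sl2_maps: vector_space "\<lambda>k (D :: 'r sl2 \<Rightarrow> 'r sl2) X. sl2_scale scale k (D X)"
  by (rule vector_space_pointwise) (rule sl2.vector_space_axioms)

lemma scale_mult_right: "scale c (x * y) = x * scale c y"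
  by (metis scale_mult_left mult.commute)

lemma linear_sl2_bracket_left:
  "Vector_Spaces.linear (sl2_scale scale) (sl2_scale scale) (\<lambda>X. sl2_bracket X Y)"
proof
  fix X X' k
  show "sl2_bracket (X + X') Y = sl2_bracket X Y + sl2_bracket X' Y"
    by (cases X; cases X'; cases Y) (simp add: algebra_simps)
  show "sl2_bracket (sl2_scale scale k X) Y = sl2_scale scale k (sl2_bracket X Y)"
    by (cases X; cases Y)
      (simp add: scale_right_distrib scale_right_diff_distrib scale_mult_left[symmetric]
        scale_mult_right[symmetric])
qed

lemma linear_sl2_bracket_right:
  "Vector_Spaces.linear (sl2_scale scale) (sl2_scale scale) (sl2_bracket X)"
proof
  fix Y Y' k
  show "sl2_bracket X (Y + Y') = sl2_bracket X Y + sl2_bracket X Y'"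
    by (cases Y; cases Y'; cases X) (simp add: algebra_simps)
  show "sl2_bracket X (sl2_scale scale k Y) = sl2_scale scale k (sl2_bracket X Y)"
    by (cases X; cases Y)
      (simp add: scale_right_distrib scale_right_diff_distrib scale_mult_left[symmetric]
        scale_mult_right[symmetric])
qed

lemma subspace_sl2_derivations:
  "sl2_maps.subspace (derivations (sl2_scale scale) sl2_bracket)"
  by (rule subspace_derivations[OF sl2.vector_space_axioms linear_sl2_bracket_left
        linear_sl2_bracket_right])

lemma subspace_inner_derivations: "sl2_maps.subspace inner_derivations"
proof -
  interpret ad: Vector_Spaces.linear "sl2_scale scale" "\<lambda>k D X. sl2_scale scale k (D X)"
    "sl2_bracket :: 'r sl2 \<Rightarrow> _"
  proof
    interpret l: Vector_Spaces.linear "sl2_scale scale" "sl2_scale scale"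
      "\<lambda>X. sl2_bracket X Y" for Y
      by (rule linear_sl2_bracket_left)
    fix X X' :: "'r sl2" and k
    show "sl2_bracket (X + X') = sl2_bracket X + sl2_bracket X'"
      by (simp add: fun_eq_iff l.add)
    show "sl2_bracket (sl2_scale scale k X) = (\<lambda>Y. sl2_scale scale k (sl2_bracket X Y))"
      by (simp add: fun_eq_iff l.scale)
  qed
  show ?thesis
    unfolding inner_derivations_def by (rule ad.subspace_image) (rule sl2.subspace_UNIV)
qed

lemma subspace_entrywise_derivations:
  "sl2_maps.subspace (sl2_map ` derivations scale (*))"
proof -
  interpret sl2_map: Vector_Spaces.linear "\<lambda>k D x. scale k (D x)"
    "\<lambda>k D X. sl2_scale scale k (D X)" "sl2_map :: ('r \<Rightarrow> 'r) \<Rightarrow> _"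
  proof
    fix f g :: "'r \<Rightarrow> 'r" and k
    show "sl2_map (f + g) = sl2_map f + sl2_map g"
      by (rule ext, rule_tac X = x in Sl2_cases) simp
    show "sl2_map (\<lambda>x. scale k (f x)) = (\<lambda>X. sl2_scale scale k (sl2_map f X))"
      by (rule ext, rule_tac X = X in Sl2_cases) simp
  qed
  have "ring_maps.subspace (derivations scale (*))"
  proof (rule subspace_derivations[OF vector_space_axioms])
    show "Vector_Spaces.linear scale scale (\<lambda>x. x * y)" for y
      by standard (simp_all add: distrib_right scale_mult_left)
    show "Vector_Spaces.linear scale scale ((*) x)" for x
      by standard (simp_all add: distrib_left scale_mult_right)
  qed
  then show ?thesis by (rule sl2_map.subspace_image)
qed

text \<open>The Leibniz rule for \<open>ad Z\<close> is the Jacobi identity.\<close>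

lemma inner_is_derivation: "sl2_bracket Z \<in> derivations (sl2_scale scale) sl2_bracket"
proof (rule derivationsI[OF sl2.vector_space_axioms])
  interpret r: Vector_Spaces.linear "sl2_scale scale" "sl2_scale scale" "sl2_bracket Z"
    by (rule linear_sl2_bracket_right)
  fix X Y k
  show "sl2_bracket Z (X + Y) = sl2_bracket Z X + sl2_bracket Z Y" by (rule r.add)
  show "sl2_bracket Z (sl2_scale scale k X) = sl2_scale scale k (sl2_bracket Z X)"
    by (rule r.scale)
  show "sl2_bracket Z (sl2_bracket X Y) =
      sl2_bracket (sl2_bracket Z X) Y + sl2_bracket X (sl2_bracket Z Y)"
    by (cases X; cases Y; cases Z) (simp add: algebra_simps)
qed

lemma ring_derivation_one:
  assumes "D \<in> derivations scale (*)"
  shows "D 1 = 0"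
  using derivationsD(5)[OF assms, of 1 1] by (simp add: mult.commute)

end


section \<open>The decomposition in characteristic other than two\<close>

locale comm_unital_algebra_char_not_2 = comm_unital_algebra scale
  for scale :: "'f::field \<Rightarrow> 'r::{comm_ring, comm_monoid_mult} \<Rightarrow> 'r" +
  assumes char_not_2: "CHAR('f) \<noteq> 2"
begin

lemma two_neq_zero: "(2::'f) \<noteq> 0"
proof
  assume "(2::'f) = 0"
  then have "of_nat 2 = (0::'f)" by simp
  then have "CHAR('f) dvd 2" by (simp only: of_nat_eq_0_iff_char_dvd)
  moreover from this have "CHAR('f) \<noteq> 0" by (metis dvd_0_left zero_neq_numeral)
  moreover from \<open>CHAR('f) dvd 2\<close> have "CHAR('f) \<le> 2" by (simp add: dvd_imp_le)
  moreover have "CHAR('f) \<noteq> 1" by simp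
  ultimately show False using char_not_2 by linarith
qed

lemma ex_half: obtains y :: 'r where "x = y + y"
proof
  have "scale (1 / 2) x + scale (1 / 2) x = scale (1 / 2 + 1 / 2) x"
    by (rule scale_left_distrib[symmetric])
  also have "1 / 2 + 1 / 2 = (1::'f)"
    using two_neq_zero by (metis add_divide_distrib divide_self one_add_one)
  finally show "x = scale (1 / 2) x + scale (1 / 2) x" by simp
qed

lemma double_eq_0 [simp]: "x + x = 0 \<longleftrightarrow> x = (0::'r)"
proof -
  have "x + x = scale (1 + 1) x" by (simp only: scale_left_distrib scale_one)
  then show ?thesis using two_neq_zero by (simp only: one_add_one scale_eq_0_iff) simp
qed

lemma double_cancel [simp]: "x + x = y + y \<longleftrightarrow> x = (y::'r)"
  using double_eq_0[of "x - y"] by (auto simp: algebra_simps)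

lemma neg_eq_self [simp]: "- x = x \<longleftrightarrow> x = (0::'r)"
  by (metis add.right_inverse double_eq_0 minus_zero)

text \<open>
  The relation \<open>H = [E, F]\<close> gives \<open>D H\<close> in terms of \<open>D E\<close> and \<open>D F\<close>, and then \<open>[H, E] = 2 E\<close> and
  \<open>[H, F] = -2 F\<close> leave just the three free parameters of \<open>Z\<close>.
\<close>

lemma derivation_agrees_with_inner:
  assumes D: "D \<in> derivations (sl2_scale scale) sl2_bracket"
  obtains Z where "D (Sl2 0 1 0) = sl2_bracket Z (Sl2 0 1 0)"
    and "D (Sl2 0 0 1) = sl2_bracket Z (Sl2 0 0 1)"
proof -
  note leibniz = derivationsD(5)[OF D] and add = derivationsD(1)[OF D]
  obtain x y z where E: "D (Sl2 0 1 0) = Sl2 x y z" by (rule Sl2_cases)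
  obtain x' y' w where F: "D (Sl2 0 0 1) = Sl2 x' y' w" by (rule Sl2_cases)
  have H: "D (Sl2 1 0 0) = Sl2 (y + w) (- (x' + x')) (- (x + x))"
    using leibniz[of "Sl2 0 1 0" "Sl2 0 0 1"] by (simp add: E F)
  have "D (Sl2 0 1 0) + D (Sl2 0 1 0) =
      sl2_bracket (D (Sl2 1 0 0)) (Sl2 0 1 0) + sl2_bracket (Sl2 1 0 0) (D (Sl2 0 1 0))"
    using leibniz[of "Sl2 1 0 0" "Sl2 0 1 0"] add[of "Sl2 0 1 0" "Sl2 0 1 0"] by simp
  then have "y + w = 0" and "- (z + z) = z + z"
    by (simp_all add: H E)
  then have w: "w = - y" and z: "z = 0"
    by (simp add: eq_neg_iff_add_eq_0 add.commute, simp only: neg_eq_self double_eq_0)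
  have "- (y' + y') = y' + y'"
    using leibniz[of "Sl2 0 0 1" "Sl2 1 0 0"] add[of "Sl2 0 0 1" "Sl2 0 0 1"]
    by (simp add: H F)
  then have y': "y' = 0" by (simp only: neg_eq_self double_eq_0)
  \<comment> \<open>For \<open>Z = Sl2 p q r\<close> one has \<open>[Z, E] = Sl2 (- r) (2 p) 0\<close> and \<open>[Z, F] = Sl2 q 0 (- 2 p)\<close>.\<close>
  obtain p where p: "y = p + p" by (rule ex_half)
  show thesis
  proof (rule that[of "Sl2 p x' (- x)"])
    show "D (Sl2 0 1 0) = sl2_bracket (Sl2 p x' (- x)) (Sl2 0 1 0)"
      by (simp add: E z p)
    show "D (Sl2 0 0 1) = sl2_bracket (Sl2 p x' (- x)) (Sl2 0 0 1)"
      by (simp add: F y' w p)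
  qed
qed

lemma inner_killing_EF:
  assumes "sl2_bracket Z (Sl2 0 1 0) = (0 :: 'r sl2)" and "sl2_bracket Z (Sl2 0 0 1) = 0"
  shows "Z = 0"
  using assms by (cases Z) (simp add: zero_Sl2)

text \<open>
  The sets of all \<open>a E\<close> and of all \<open>a F\<close> arise from that of all \<open>a H\<close> by bracketing with elements
  that \<open>D\<close> kills, so \<open>D\<close> acts on all three through one and the same map of the ring.
\<close>

lemma derivation_killing_EF_entrywise:
  assumes D: "D \<in> derivations (sl2_scale scale) sl2_bracket"
    and E: "D (Sl2 0 1 0) = 0" and F: "D (Sl2 0 0 1) = 0"
  obtains d where "d \<in> derivations scale (*)" and "D = sl2_map d"
proof -
  note leibniz = derivationsD(5)[OF D] and add = derivationsD(1)[OF D]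
    and scale = derivationsD(4)[OF D]
  have br0: "sl2_bracket 0 X = 0" "sl2_bracket X 0 = 0" for X :: "'r sl2"
    by (cases X, simp add: zero_Sl2)+
  have H: "D (Sl2 1 0 0) = 0"
    using leibniz[of "Sl2 0 1 0" "Sl2 0 0 1"] by (simp add: E F br0)
  \<comment> \<open>\<open>D\<close> commutes with \<open>ad H\<close>, whose kernel consists of the \<open>a H\<close>.\<close>
  have "\<exists>d. D (Sl2 a 0 0) = Sl2 d 0 0" for a
  proof -
    obtain x y z where xyz: "D (Sl2 a 0 0) = Sl2 x y z" by (rule Sl2_cases)
    have "sl2_bracket (Sl2 1 0 0) (D (Sl2 a 0 0)) = 0"
      using leibniz[of "Sl2 1 0 0" "Sl2 a 0 0"] derivationsD(3)[OF D]
      by (simp add: H br0 flip: zero_Sl2)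
    then have "y = 0" "z = 0" by (simp_all add: xyz zero_Sl2)
    then show ?thesis using xyz by blast
  qed
  then obtain d where dH: "D (Sl2 a 0 0) = Sl2 (d a) 0 0" for a by metis
  \<comment> \<open>\<open>a E = [b H, E]\<close> and \<open>a F = [F, b H]\<close> where \<open>b\<close> is half of \<open>a\<close>.\<close>
  have dE: "D (Sl2 0 a 0) = Sl2 0 (d a) 0" for a
  proof -
    obtain b where b: "a = b + b" by (rule ex_half)
    have "d (b + b) = d b + d b"
      using add[of "Sl2 b 0 0" "Sl2 b 0 0"] by (simp add: dH)
    then show ?thesis
      using leibniz[of "Sl2 b 0 0" "Sl2 0 1 0"] by (simp add: dH E br0 b)
  qed
  have dF: "D (Sl2 0 0 a) = Sl2 0 0 (d a)" for a
  proof -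
    obtain b where b: "a = b + b" by (rule ex_half)
    have "d (b + b) = d b + d b"
      using add[of "Sl2 b 0 0" "Sl2 b 0 0"] by (simp add: dH)
    then show ?thesis
      using leibniz[of "Sl2 0 0 1" "Sl2 b 0 0"] by (simp add: dH F br0 b)
  qed
  show thesis
  proof (rule that)
    show "d \<in> derivations scale (*)"
    proof (rule derivationsI[OF vector_space_axioms])
      fix a b k
      show "d (a + b) = d a + d b" using add[of "Sl2 a 0 0" "Sl2 b 0 0"] by (simp add: dH)
      show "d (scale k a) = scale k (d a)" using scale[of k "Sl2 a 0 0"] by (simp add: dH)
      show "d (a * b) = d a * b + a * d b"
        using leibniz[of "Sl2 0 a 0" "Sl2 0 0 b"] by (simp add: dH dE dF)
    qed
    show "D = sl2_map d"
    proof
      fix X :: "'r sl2"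
      obtain a b c where X: "X = Sl2 a b c" by (rule Sl2_cases)
      have "Sl2 a b c = Sl2 a 0 0 + Sl2 0 b 0 + Sl2 0 0 c" by simp
      then have "D X = D (Sl2 a 0 0) + D (Sl2 0 b 0) + D (Sl2 0 0 c)"
        unfolding X by (simp only: add)
      then show "D X = sl2_map d X" by (simp add: dH dE dF X)
    qed
  qed
qed

lemma derivation_decomposition:
  assumes D: "D \<in> derivations (sl2_scale scale) sl2_bracket"
  obtains Z d where "d \<in> derivations scale (*)" and "D = sl2_bracket Z + sl2_map d"
proof -
  obtain Z where Z: "D (Sl2 0 1 0) = sl2_bracket Z (Sl2 0 1 0)"
      "D (Sl2 0 0 1) = sl2_bracket Z (Sl2 0 0 1)"
    using derivation_agrees_with_inner[OF D] .
  have "D - sl2_bracket Z \<in> derivations (sl2_scale scale) sl2_bracket"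
    by (rule sl2_maps.subspace_diff[OF subspace_sl2_derivations D inner_is_derivation])
  then obtain d where "d \<in> derivations scale (*)" and "D - sl2_bracket Z = sl2_map d"
    by (rule derivation_killing_EF_entrywise) (simp_all add: Z)
  then show thesis by (intro that) (simp_all add: algebra_simps)
qed

lemma inner_entrywise_eq_0:
  assumes d: "d \<in> derivations scale (*)" and eq: "sl2_bracket Z = sl2_map d"
  shows "sl2_bracket Z = 0"
proof -
  note d0 = derivationsD(3)[OF d] and d1 = ring_derivation_one[OF d]
  have "Z = 0"
    by (rule inner_killing_EF) (simp_all add: eq d0 d1 zero_Sl2)
  then show ?thesis
    by (intro ext, rule_tac X = x in Sl2_cases) (simp add: zero_Sl2)
qed

end

theorem proposition11:
  fixes scale :: "'f::field \<Rightarrow> 'r::{comm_ring, comm_monoid_mult} \<Rightarrow> 'r"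
  assumes "comm_unital_algebra scale" and "CHAR('f) \<noteq> 2"
  shows "internal_direct_sum
           (\<lambda>k D X. sl2_scale scale k (D X))
           (derivations (sl2_scale scale) sl2_bracket)
           inner_derivations
           (sl2_map ` derivations scale (*))"
proof -
  interpret comm_unital_algebra_char_not_2 scale
    using assms by (intro comm_unital_algebra_char_not_2.intro
        comm_unital_algebra_char_not_2_axioms.intro)
  let ?Der = "derivations (sl2_scale scale) sl2_bracket"
  let ?W = "sl2_map ` derivations scale (*)"
  have sum_in: "u + w \<in> ?Der" if "u \<in> inner_derivations" "w \<in> ?W" for u w
  proof (rule sl2_maps.subspace_add[OF subspace_sl2_derivations])
    show "u \<in> ?Der" using that(1) inner_is_derivation unfolding inner_derivations_def by blast
    show "w \<in> ?Der" using that(2) sl2_map_derivation by blast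
  qed
  have ex_sum: "\<exists>u w. D = u + w \<and> u \<in> inner_derivations \<and> w \<in> ?W" if D: "D \<in> ?Der" for D
  proof -
    obtain Z d where "d \<in> derivations scale (*)" and "D = sl2_bracket Z + sl2_map d"
      by (rule derivation_decomposition[OF D])
    then show ?thesis unfolding inner_derivations_def by blast
  qed
  have sum: "?Der = {u + w | u w. u \<in> inner_derivations \<and> w \<in> ?W}"
  proof (intro equalityI subsetI CollectI)
    show "\<exists>u w. D = u + w \<and> u \<in> inner_derivations \<and> w \<in> ?W" if "D \<in> ?Der" for D
      using that by (rule ex_sum)
    show "D \<in> ?Der" if "D \<in> {u + w | u w. u \<in> inner_derivations \<and> w \<in> ?W}" for D
      using that sum_in by blast
  qed
  have direct: "inner_derivations \<inter> ?W = {0}"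
  proof
    show "inner_derivations \<inter> ?W \<subseteq> {0}"
      using inner_entrywise_eq_0 unfolding inner_derivations_def by blast
    show "{0} \<subseteq> inner_derivations \<inter> ?W"
      using sl2_maps.subspace_0[OF subspace_inner_derivations]
        sl2_maps.subspace_0[OF subspace_entrywise_derivations] by simp
  qed
  show ?thesis
    unfolding internal_direct_sum_def
    by (rule conjI[OF subspace_inner_derivations
          conjI[OF subspace_entrywise_derivations conjI[OF sum direct]]])
qed

end
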